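(* Let $G$ be a finite connected multigraph without self-loops, let $H\subsetneq G$ be a homogeneous core of $G$, and let $G/H$ be the result of shrinking $H$ to a single node and pruning away any self-loops. Then $$\mathrm{MEO}(\Gamma_G)=\mathrm{MEO}(\Gamma_H)+\mathrm{MEO}(\Gamma_{G/H}).$$ Moreover, the optimal pmfs for $\mathrm{MEO}(\Gamma_G)$ are those obtained by coupling optimal pmfs for $\mathrm{MEO}(\Gamma_H)$ and $\mathrm{MEO}(\Gamma_{G/H})$: every coupling of an optimal pmf for $\mathrm{MEO}(\Gamma_H)$ with an optimal pmf for $\mathrm{MEO}(\Gamma_{G/H})$ yields an optimal pmf for $\mathrm{MEO}(\Gamma_G)$, and every optimal pmf for $\mathrm{MEO}(\Gamma_G)$ arises in this way.
   Context: Multigraphs may have parallel edges but no self-loops. For a finite connected multigraph $G=(V_G,E_G)$, $\Gamma_G$ is the set of spanning trees of $G$, regarded as subsets of $E_G$; $\mathcal{P}(\Gamma_G)$ is the set of probability mass functions (pmfs) on $\Gamma_G$. $\mathrm{MEO}(\Gamma_G)=\min_{\mu\in\mathcal{P}(\Gamma_G)}\sum_{\gamma,\gamma'\in\Gamma_G}|\gamma\cap\gamma'|\,\mu(\gamma)\mu(\gamma')$, and a pmf attaining the minimum is called optimal. The edge usage probabilities $\eta^*(e)=\sum_{\gamma\ni e}\mu^*(\gamma)$ are the same for every optimal $\mu^*$; $G$ is homogeneous if $\eta^*$ is constant. A spanning tree $\gamma$ is fair if $\mu^*(\gamma)>0$ for some optimal $\mu^*$. A homogeneous core of $G$ is a connected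 subgraph $H=(V_H,E_H)$ which (1) has at least one edge, (2) satisfies that $\gamma\cap E_H$ is a spanning tree of $H$ for every fair tree $\gamma$ of $G$, (3) is vertex-induced (contains every edge of $G$ with both endpoints in $V_H$), and (4) is itself homogeneous. $G/H$ is the multigraph with vertex set $(V_G\setminus V_H)\cup\{v_H\}$ obtained by identifying all vertices of $V_H$ to the single vertex $v_H$, deleting the edges of $E_H$, and keeping all other edges with multiplicity; this gives a bijection $\varphi:E_G\setminus E_H\to E_{G/H}$. A coupling of $\mu_1\in\mathcal{P}(\Gamma_H)$ and $\mu_2\in\mathcal{P}(\Gamma_{G/H})$ is a pmf on $\Gamma_H\times\Gamma_{G/H}$ with marginals $\mu_1,\mu_2$; it is viewed as a pmf on subsets of $E_G$ via $(\gamma_1,\gamma_2)\mapsto\gamma_1\cup\varphi^{-1}(\gamma_2)$. *)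

theory Defs
  imports "HOL-Probability.Probability"
begin

section \<open>Multigraphs\<close>

text \<open>
  Edges are labels of an arbitrary type, so parallel edges are distinct labels with the same set of
  endpoints, and a set of edges is a set of labels. The values of \<open>ends\<close> outside \<open>edges\<close> are
  irrelevant, so two records may denote the same graph without being equal.
\<close>

record ('v, 'e) multigraph =
  verts :: "'v set"
  edges :: "'e set"
  ends :: "'e \<Rightarrow> 'v set"

definition finite_multigraph :: "('v, 'e) multigraph \<Rightarrow> bool" where
  "finite_multigraph G \<longleftrightarrow> finite (verts G) \<and> finite (edges G) \<and>
     (\<forall>e\<in>edges G. ends G e \<subseteq> verts G \<and> card (ends G e) = 2)"

text \<open>A walk from \<open>u\<close> to \<open>v\<close> is the list of its steps (edge traversed, vertex reached).\<close>

fun walk :: "('v, 'e) multigraph \<Rightarrow> 'v \<Rightarrow> ('e \<times> 'v) list \<Rightarrow> 'v \<Rightarrow> bool" where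
  "walk G u [] v \<longleftrightarrow> u = v \<and> u \<in> verts G"
| "walk G u ((e, w) # p) v \<longleftrightarrow> e \<in> edges G \<and> ends G e = {u, w} \<and> walk G w p v"

definition connected_graph :: "('v, 'e) multigraph \<Rightarrow> bool" where
  "connected_graph G \<longleftrightarrow> verts G \<noteq> {} \<and> (\<forall>u\<in>verts G. \<forall>v\<in>verts G. \<exists>p. walk G u p v)"

text \<open>
  Distinctness of the edges is required separately from that of the vertices: two parallel edges
  form a cycle, but one edge traversed back and forth does not.
\<close>

definition is_cycle :: "('v, 'e) multigraph \<Rightarrow> 'v \<Rightarrow> ('e \<times> 'v) list \<Rightarrow> bool" where
  "is_cycle G u p \<longleftrightarrow> p \<noteq> [] \<and> walk G u p u \<and> distinct (map fst p) \<and> distinct (map snd p)"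

definition is_tree :: "('v, 'e) multigraph \<Rightarrow> bool" where
  "is_tree G \<longleftrightarrow> connected_graph G \<and> \<not> (\<exists>u p. is_cycle G u p)"

definition spanning_trees :: "('v, 'e) multigraph \<Rightarrow> 'e set set" where
  "spanning_trees G = {\<gamma>. \<gamma> \<subseteq> edges G \<and> is_tree (G\<lparr>edges := \<gamma>\<rparr>)}"

definition is_subgraph :: "('v, 'e) multigraph \<Rightarrow> ('v, 'e) multigraph \<Rightarrow> bool" where
  "is_subgraph H G \<longleftrightarrow> finite_multigraph H \<and> verts H \<subseteq> verts G \<and> edges H \<subseteq> edges G \<and>
     (\<forall>e\<in>edges H. ends H e = ends G e)"

definition is_proper_subgraph :: "('v, 'e) multigraph \<Rightarrow> ('v, 'e) multigraph \<Rightarrow> bool" where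
  "is_proper_subgraph H G \<longleftrightarrow>
     is_subgraph H G \<and> \<not> (verts H = verts G \<and> edges H = edges G)"

text \<open>
  \<open>shrink G H\<close> is $G/H$: \<open>None\<close> is the new vertex $v_H$. The surviving edges keep their labels,
  so the bijection \<open>\<phi>\<close> from \<open>edges G - edges H\<close> to \<open>edges (shrink G H)\<close> is the identity. For
  vertex-induced \<open>H\<close>, the edges that become self-loops are precisely those of \<open>H\<close>.
\<close>

definition shrink_vertex :: "('v, 'e) multigraph \<Rightarrow> 'v \<Rightarrow> 'v option" where
  "shrink_vertex H v = (if v \<in> verts H then None else Some v)"

definition shrink :: "('v, 'e) multigraph \<Rightarrow> ('v, 'e) multigraph \<Rightarrow> ('v option, 'e) multigraph" where
  "shrink G H =
     \<lparr>verts = insert None (Some ` (verts G - verts H)),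
      edges = edges G - edges H,
      ends = (\<lambda>e. shrink_vertex H ` ends G e)\<rparr>"


section \<open>Minimum expected overlap\<close>

definition tree_pmfs :: "('v, 'e) multigraph \<Rightarrow> 'e set pmf set" where
  "tree_pmfs G = {\<mu>. set_pmf \<mu> \<subseteq> spanning_trees G}"

definition expected_overlap :: "('v, 'e) multigraph \<Rightarrow> 'e set pmf \<Rightarrow> real" where
  "expected_overlap G \<mu> =
     (\<Sum>\<gamma>\<in>spanning_trees G. \<Sum>\<gamma>'\<in>spanning_trees G. real (card (\<gamma> \<inter> \<gamma>')) * pmf \<mu> \<gamma> * pmf \<mu> \<gamma>')"

text \<open>
  The infimum is a minimum whenever \<open>G\<close> is finite and has a spanning tree; see \<open>optimal_exists\<close>.
\<close>

definition MEO :: "('v, 'e) multigraph \<Rightarrow> real" where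
  "MEO G = (INF \<mu>\<in>tree_pmfs G. expected_overlap G \<mu>)"

definition optimal :: "('v, 'e) multigraph \<Rightarrow> 'e set pmf \<Rightarrow> bool" where
  "optimal G \<mu> \<longleftrightarrow> \<mu> \<in> tree_pmfs G \<and> expected_overlap G \<mu> = MEO G"

definition usage :: "('v, 'e) multigraph \<Rightarrow> 'e set pmf \<Rightarrow> 'e \<Rightarrow> real" where
  "usage G \<mu> e = (\<Sum>\<gamma> | \<gamma> \<in> spanning_trees G \<and> e \<in> \<gamma>. pmf \<mu> \<gamma>)"

text \<open>
  The common usage probabilities \<open>\<eta>\<^sup>*\<close> of all optimal pmfs; well defined by \<open>optimal_exists\<close>
  and \<open>optimal_usage_unique\<close>.
\<close>

definition optimal_usage :: "('v, 'e) multigraph \<Rightarrow> 'e \<Rightarrow> real" where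
  "optimal_usage G e = (THE x. \<exists>\<mu>. optimal G \<mu> \<and> x = usage G \<mu> e)"

definition homogeneous :: "('v, 'e) multigraph \<Rightarrow> bool" where
  "homogeneous G \<longleftrightarrow> (\<exists>c. \<forall>e\<in>edges G. optimal_usage G e = c)"

definition fair_trees :: "('v, 'e) multigraph \<Rightarrow> 'e set set" where
  "fair_trees G = {\<gamma> \<in> spanning_trees G. \<exists>\<mu>. optimal G \<mu> \<and> pmf \<mu> \<gamma> > 0}"

definition homogeneous_core :: "('v, 'e) multigraph \<Rightarrow> ('v, 'e) multigraph \<Rightarrow> bool" where
  "homogeneous_core H G \<longleftrightarrow>
     is_subgraph H G \<and> connected_graph H \<and>
     edges H \<noteq> {} \<and>
     (\<forall>\<gamma>\<in>fair_trees G. \<gamma> \<inter> edges H \<in> spanning_trees H) \<and>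
     (\<forall>e\<in>edges G. ends G e \<subseteq> verts H \<longrightarrow> e \<in> edges H) \<and>
     homogeneous H"

definition is_coupling :: "('a \<times> 'b) pmf \<Rightarrow> 'a pmf \<Rightarrow> 'b pmf \<Rightarrow> bool" where
  "is_coupling \<pi> \<mu>\<^sub>1 \<mu>\<^sub>2 \<longleftrightarrow> map_pmf fst \<pi> = \<mu>\<^sub>1 \<and> map_pmf snd \<pi> = \<mu>\<^sub>2"

text \<open>A pmf on pairs of edge sets, viewed as a pmf on edge sets.\<close>

definition union_pmf :: "('e set \<times> 'e set) pmf \<Rightarrow> 'e set pmf" where
  "union_pmf \<pi> = map_pmf (\<lambda>(\<gamma>\<^sub>1, \<gamma>\<^sub>2). \<gamma>\<^sub>1 \<union> \<gamma>\<^sub>2) \<pi>"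


section \<open>Well-definedness\<close>

lemma finite_spanning_trees: "finite_multigraph G \<Longrightarrow> finite (spanning_trees G)"
  unfolding spanning_trees_def finite_multigraph_def by auto

lemma walk_mono: "walk G u p v \<Longrightarrow> fst ` set p \<inter> edges G \<subseteq> F \<Longrightarrow> walk (G\<lparr>edges := F\<rparr>) u p v"
  by (induction G u p v rule: walk.induct) auto

lemma walk_append: "walk G u p v \<Longrightarrow> walk G v q w \<Longrightarrow> walk G u (p @ q) w"
  by (induction G u p v rule: walk.induct) auto

lemma walk_ends:
  "finite_multigraph G \<Longrightarrow> walk G u p v \<Longrightarrow> u \<in> verts G \<and> v \<in> verts G"
  by (induction G u p v rule: walk.induct) (auto simp: finite_multigraph_def)

lemma walk_rev: "finite_multigraph G \<Longrightarrow> walk G u p v \<Longrightarrow> \<exists>q. walk G v q u \<and> fst ` set q = fst ` set p"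
proof (induction G u p v rule: walk.induct)
  case (1 G u v)
  then show ?case by (intro exI[of _ "[]"]) auto
next
  case (2 G u e w p v)
  then obtain q where q: "walk G v q w" "fst ` set q = fst ` set p" by auto
  have u: "u \<in> verts G" "walk G w [(e, u)] u"
    using 2 by (auto simp: finite_multigraph_def)
  show ?case
    using walk_append[OF q(1) u(2)] q(2) by (intro exI[of _ "q @ [(e, u)]"]) auto
qed

text \<open>An edge whose endpoints are joined by a walk avoiding it can be removed.\<close>

lemma walk_detour:
  assumes fin: "finite_multigraph G" and d: "walk (G\<lparr>edges := edges G - {e}\<rparr>) a d b"
    and e: "ends G e = {a, b}"
    and w: "walk G u p v"
  shows "\<exists>q. walk (G\<lparr>edges := edges G - {e}\<rparr>) u q v"
  using w
proof (induction p arbitrary: u)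
  case Nil
  then show ?case by (intro exI[of _ "[]"]) auto
next
  case (Cons s p)
  obtain f x where s: "s = (f, x)" by (cases s)
  let ?G = "G\<lparr>edges := edges G - {e}\<rparr>"
  have fin': "finite_multigraph ?G" using fin by (auto simp: finite_multigraph_def)
  obtain q where q: "walk ?G x q v" using Cons s by auto
  have f: "f \<in> edges G" "ends G f = {u, x}" using Cons s by auto
  show ?case
  proof (cases "f = e")
    case False
    then have "walk ?G u ((f, x) # q) v" using f q by auto
    then show ?thesis by blast
  next
    case True
    then have "(u = a \<and> x = b) \<or> (u = b \<and> x = a)" using f e by (auto simp: doubleton_eq_iff)
    then obtain r where "walk ?G u r x" using d walk_rev[OF fin' d] by auto
    then show ?thesis using walk_append[OF _ q] by blast
  qed
qed

lemma spanning_trees_nonempty: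
  assumes fin: "finite_multigraph G" and con: "connected_graph G"
  shows "spanning_trees G \<noteq> {}"
proof -
  let ?P = "\<lambda>F. F \<subseteq> edges G \<and> connected_graph (G\<lparr>edges := F\<rparr>)"
  have "?P (edges G)" using con by simp
  then obtain F where F: "?P F" and min: "\<And>F'. ?P F' \<Longrightarrow> card F \<le> card F'"
    using ex_has_least_nat[of ?P "edges G" card] by blast
  let ?G = "G\<lparr>edges := F\<rparr>"
  have finF: "finite F" using F fin by (auto simp: finite_multigraph_def intro: finite_subset)
  have finG: "finite_multigraph ?G" using fin F finF by (auto simp: finite_multigraph_def)
  have "\<not> is_cycle ?G u p" for u p
  proof
    assume c: "is_cycle ?G u p"
    then obtain e w q where p: "p = (e, w) # q" by (cases p) (auto simp: is_cycle_def)
    have e: "e \<in> F" "ends G e = {w, u}" and q: "walk ?G w q u" and nq: "e \<notin> fst ` set q"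
      using c unfolding p is_cycle_def by auto
    have "walk (?G\<lparr>edges := edges ?G - {e}\<rparr>) w q u"
      by (rule walk_mono[OF q]) (use nq in auto)
    then have "\<exists>r. walk (?G\<lparr>edges := edges ?G - {e}\<rparr>) x r y" if "walk ?G x s y" for x s y
      using walk_detour[OF finG _ _ that, of e w q u] e by auto
    then have "connected_graph (G\<lparr>edges := F - {e}\<rparr>)"
      using F by (fastforce simp: connected_graph_def)
    then have "card F \<le> card (F - {e})" using F by (intro min) auto
    then show False using card_Diff1_less[OF finF e(1)] by simp
  qed
  then have "F \<in> spanning_trees G" using F by (auto simp: spanning_trees_def is_tree_def)
  then show ?thesis by blast
qed

lemma expected_overlap_usage:
  assumes fin: "finite_multigraph G"
  shows "expected_overlap G \<mu> = (\<Sum>e\<in>edges G. (usage G \<mu> e)\<^sup>2)"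
proof -
  let ?T = "spanning_trees G"
  have finT: "finite ?T" and finE: "finite (edges G)"
    using fin finite_spanning_trees by (auto simp: finite_multigraph_def)
  have us: "usage G \<mu> e = (\<Sum>\<gamma>\<in>?T. of_bool (e \<in> \<gamma>) * pmf \<mu> \<gamma>)" for e
    unfolding usage_def using finT by (intro sum.mono_neutral_cong_left) auto
  have ca: "real (card (\<gamma> \<inter> \<gamma>')) = (\<Sum>e\<in>edges G. of_bool (e \<in> \<gamma>) * of_bool (e \<in> \<gamma>'))"
    if "\<gamma> \<in> ?T" for \<gamma> \<gamma>'
  proof -
    have "\<gamma> \<subseteq> edges G" using that by (auto simp: spanning_trees_def)
    then have "(\<Sum>e\<in>edges G. of_bool (e \<in> \<gamma>) * of_bool (e \<in> \<gamma>')) = (\<Sum>e\<in>\<gamma> \<inter> \<gamma>'. 1 :: real)"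
      using finE by (intro sum.mono_neutral_cong_right) auto
    then show ?thesis by simp
  qed
  have "expected_overlap G \<mu> = (\<Sum>\<gamma>\<in>?T. \<Sum>\<gamma>'\<in>?T. \<Sum>e\<in>edges G.
      (of_bool (e \<in> \<gamma>) * pmf \<mu> \<gamma>) * (of_bool (e \<in> \<gamma>') * pmf \<mu> \<gamma>'))"
    unfolding expected_overlap_def
    by (intro sum.cong refl) (simp only: ca sum_distrib_right, intro sum.cong refl, simp)
  also have "\<dots> = (\<Sum>\<gamma>\<in>?T. \<Sum>e\<in>edges G. \<Sum>\<gamma>'\<in>?T.
      (of_bool (e \<in> \<gamma>) * pmf \<mu> \<gamma>) * (of_bool (e \<in> \<gamma>') * pmf \<mu> \<gamma>'))"
    by (intro sum.cong refl sum.swap)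
  also have "\<dots> = (\<Sum>e\<in>edges G. \<Sum>\<gamma>\<in>?T. \<Sum>\<gamma>'\<in>?T.
      (of_bool (e \<in> \<gamma>) * pmf \<mu> \<gamma>) * (of_bool (e \<in> \<gamma>') * pmf \<mu> \<gamma>'))"
    by (rule sum.swap)
  also have "\<dots> = (\<Sum>e\<in>edges G. (usage G \<mu> e)\<^sup>2)"
    by (simp only: us power2_eq_square sum_product)
  finally show ?thesis .
qed

lemma expected_overlap_nonneg: "0 \<le> expected_overlap G \<mu>"
  unfolding expected_overlap_def by (intro sum_nonneg mult_nonneg_nonneg) auto

lemma MEO_le: "\<mu> \<in> tree_pmfs G \<Longrightarrow> MEO G \<le> expected_overlap G \<mu>"
  unfolding MEO_def
  by (rule cINF_lower) (auto intro!: bdd_belowI2[where m = 0] expected_overlap_nonneg)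

lemma optimal_exists:
  assumes fin: "finite_multigraph G" and con: "connected_graph G"
  shows "\<exists>\<mu>. optimal G \<mu>"
proof -
  define T where "T = spanning_trees G"
  have finT: "finite T" using fin finite_spanning_trees by (auto simp: T_def)
  define B where "B = PiE UNIV (\<lambda>\<gamma>. if \<gamma> \<in> T then {0..1::real} else {0})"
  define K where "K = B \<inter> {f. (\<Sum>\<gamma>\<in>T. f \<gamma>) = 1}"
  define q where "q f = (\<Sum>\<gamma>\<in>T. \<Sum>\<gamma>'\<in>T. real (card (\<gamma> \<inter> \<gamma>')) * f \<gamma> * f \<gamma>')"
    for f :: "'b set \<Rightarrow> real"
  have q: "expected_overlap G \<mu> = q (pmf \<mu>)" for \<mu>
    by (simp add: expected_overlap_def q_def T_def)
  have "compactin (product_topology (\<lambda>_. euclidean) UNIV) B"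
    unfolding B_def by (subst compactin_PiE) (auto simp: compactin_euclidean_iff)
  then have "compact B"
    by (simp add: euclidean_product_topology compactin_euclidean_iff)
  moreover have cont: "continuous_on UNIV (\<lambda>f. f \<gamma> :: real)" for \<gamma> :: "'b set"
    by (rule continuous_on_product_coordinates)
  have "closed {f. (\<Sum>\<gamma>\<in>T. f \<gamma>) = (1::real)}"
    by (intro closed_Collect_eq continuous_intros cont)
  ultimately have "compact K" unfolding K_def by (rule compact_Int_closed)
  have K: "pmf \<mu> \<in> K" if "\<mu> \<in> tree_pmfs G" for \<mu>
  proof -
    have "set_pmf \<mu> \<subseteq> T" using that by (simp add: tree_pmfs_def T_def)
    then show ?thesis
      using sum_pmf_eq_1[OF finT] by (auto simp: K_def B_def pmf_le_1 set_pmf_eq)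
  qed
  obtain \<gamma>0 where "\<gamma>0 \<in> T" using spanning_trees_nonempty[OF fin con] by (auto simp: T_def)
  then have ne: "return_pmf \<gamma>0 \<in> tree_pmfs G" by (simp add: tree_pmfs_def T_def)
  have "continuous_on K q"
    unfolding q_def by (intro continuous_intros continuous_on_subset[OF cont]) auto
  then obtain f where f: "f \<in> K" "\<And>g. g \<in> K \<Longrightarrow> q f \<le> q g"
    using continuous_attains_inf[OF \<open>compact K\<close>] K[OF ne] by blast
  have fB: "f \<gamma> \<in> (if \<gamma> \<in> T then {0..1} else {0})" for \<gamma>
    using f(1) by (simp add: K_def B_def PiE_iff)
  have f0: "f \<gamma> = 0" if "\<gamma> \<notin> T" for \<gamma> using fB[of \<gamma>] that by simp
  have fpos: "0 \<le> f \<gamma>" for \<gamma> using fB[of \<gamma>] by (auto split: if_splits)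
  have "(\<integral>\<^sup>+ \<gamma>. ennreal (f \<gamma>) \<partial>count_space UNIV) = (\<Sum>\<gamma>\<in>T. ennreal (f \<gamma>))"
    using finT f0 by (intro nn_integral_count_space'[OF finT]) auto
  also have "\<dots> = 1" using f(1) fpos by (simp add: K_def sum_ennreal)
  finally have pe: "pmf (embed_pmf f) = f"
    using fpos by (intro ext pmf_embed_pmf) auto
  have "set_pmf (embed_pmf f) \<subseteq> T" using f0 by (auto simp: set_pmf_eq pe)
  then have mem: "embed_pmf f \<in> tree_pmfs G" by (simp add: tree_pmfs_def T_def)
  have "expected_overlap G (embed_pmf f) \<le> MEO G"
    unfolding MEO_def
  proof (rule cINF_greatest)
    show "tree_pmfs G \<noteq> {}" using ne by blast
    fix \<mu> assume "\<mu> \<in> tree_pmfs G"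
    then show "expected_overlap G (embed_pmf f) \<le> expected_overlap G \<mu>"
      using f(2) K by (simp add: q pe)
  qed
  then have "optimal G (embed_pmf f)" using MEO_le[OF mem] mem by (simp add: optimal_def)
  then show ?thesis by blast
qed

lemma optimal_usage_unique:
  assumes fin: "finite_multigraph G" and "optimal G \<mu>" "optimal G \<nu>" and e: "e \<in> edges G"
  shows "usage G \<mu> e = usage G \<nu> e"
proof -
  define \<rho> where "\<rho> = bernoulli_pmf (1/2) \<bind> (\<lambda>b. if b then \<mu> else \<nu>)"
  have p: "pmf \<rho> \<gamma> = (pmf \<mu> \<gamma> + pmf \<nu> \<gamma>) / 2" for \<gamma>
    by (simp add: \<rho>_def pmf_bind)
  have "set_pmf \<rho> \<subseteq> set_pmf \<mu> \<union> set_pmf \<nu>" by (auto simp: \<rho>_def split: if_splits)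
  then have "\<rho> \<in> tree_pmfs G" using assms by (auto simp: optimal_def tree_pmfs_def)
  then have "MEO G \<le> expected_overlap G \<rho>" by (rule MEO_le)
  moreover have "usage G \<rho> e = (usage G \<mu> e + usage G \<nu> e) / 2" for e
    by (simp add: usage_def p sum.distrib sum_divide_distrib add_divide_distrib)
  ultimately have le: "MEO G \<le> (\<Sum>e\<in>edges G. ((usage G \<mu> e + usage G \<nu> e) / 2)\<^sup>2)"
    by (simp add: expected_overlap_usage[OF fin])
  have \<mu>: "(\<Sum>e\<in>edges G. (usage G \<mu> e)\<^sup>2) = MEO G" and \<nu>: "(\<Sum>e\<in>edges G. (usage G \<nu> e)\<^sup>2) = MEO G"
    using assms by (auto simp: optimal_def expected_overlap_usage[OF fin])
  have "(\<Sum>e\<in>edges G. (usage G \<mu> e - usage G \<nu> e)\<^sup>2)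
      = (\<Sum>e\<in>edges G. 2 * (usage G \<mu> e)\<^sup>2 + 2 * (usage G \<nu> e)\<^sup>2
          - 4 * ((usage G \<mu> e + usage G \<nu> e) / 2)\<^sup>2)"
    by (intro sum.cong refl) (simp add: power2_eq_square algebra_simps)
  also have "\<dots> = 4 * MEO G - 4 * (\<Sum>e\<in>edges G. ((usage G \<mu> e + usage G \<nu> e) / 2)\<^sup>2)"
    by (simp add: sum.distrib sum_subtractf flip: sum_distrib_left \<mu> \<nu>) (simp add: \<mu> \<nu>)
  also have "\<dots> \<le> 0" using le by simp
  finally have "(\<Sum>e\<in>edges G. (usage G \<mu> e - usage G \<nu> e)\<^sup>2) = 0"
    by (intro antisym sum_nonneg) auto
  then show ?thesis
    using fin e by (subst (asm) sum_nonneg_eq_0_iff) (auto simp: finite_multigraph_def)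
qed

lemma optimal_usage_eq:
  assumes "finite_multigraph G" "optimal G \<mu>" "e \<in> edges G"
  shows "optimal_usage G e = usage G \<mu> e"
  unfolding optimal_usage_def
proof (rule the_equality)
  show "\<exists>\<nu>. optimal G \<nu> \<and> usage G \<mu> e = usage G \<nu> e" using assms by blast
next
  fix x assume "\<exists>\<nu>. optimal G \<nu> \<and> x = usage G \<nu> e"
  then obtain \<nu> where "optimal G \<nu>" "x = usage G \<nu> e" by blast
  then show "x = usage G \<mu> e" using optimal_usage_unique[of G \<nu> \<mu> e] assms by simp
qed

lemma finite_multigraph_shrink:
  assumes G: "finite_multigraph G" and H: "homogeneous_core H G"
  shows "finite_multigraph (shrink G H)"
proof -
  have "shrink_vertex H ` ends G e \<subseteq> insert None (Some ` (verts G - verts H))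
      \<and> card (shrink_vertex H ` ends G e) = 2" if "e \<in> edges G - edges H" for e
  proof -
    have "card (ends G e) = 2" and sub: "ends G e \<subseteq> verts G"
      using G that by (auto simp: finite_multigraph_def)
    then obtain u v where e: "ends G e = {u, v}" "u \<noteq> v" by (meson card_2_iff)
    have "\<not> ends G e \<subseteq> verts H" using that H by (auto simp: homogeneous_core_def)
    then have "u \<notin> verts H \<or> v \<notin> verts H" and "{u, v} \<subseteq> verts G"
      using e sub by auto
    moreover from this have "shrink_vertex H u \<noteq> shrink_vertex H v"
      using \<open>u \<noteq> v\<close> by (auto simp: shrink_vertex_def)
    ultimately show ?thesis by (simp add: e) (simp add: shrink_vertex_def)
  qed
  then show ?thesis using G by (simp add: finite_multigraph_def shrink_def)
qed

end

theory Submission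
  imports Defs
begin

text \<open>
  A set of edges of \<open>G\<close> that meets \<open>H\<close> in a spanning tree of \<open>H\<close> is a spanning tree of \<open>G\<close> if and
  only if its remaining edges form a spanning tree of \<open>G/H\<close>. Hence a pair consisting of a spanning
  tree of \<open>H\<close> and one of \<open>G/H\<close> is the same thing as a spanning tree of \<open>G\<close> that restricts to a
  spanning tree of \<open>H\<close>, and a coupling of pmfs on the two factors is the same thing as a pmf on
  such trees of \<open>G\<close>.

  The expected overlap of a pmf is the sum of the squares of its edge usage probabilities. The
  usage of an edge of \<open>H\<close> depends only on the first marginal of a coupling and the usage of any
  other edge only on the second one, so the expected overlap of a coupled pmf is the sum of
  the expected overlaps of its marginals, whatever the dependence between them
  (\<open>expected_overlap_union_pmf\<close>).

  Coupling optimal pmfs of \<open>H\<close> and \<open>G/H\<close> gives \<open>MEO G \<le> MEO H + MEO (shrink G H)\<close>. Conversely, an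
  optimal pmf of \<open>G\<close> is supported on fair trees; by the defining property of a homogeneous core
  these all restrict to spanning trees of \<open>H\<close>, so the pmf is itself a coupling, and its value is at
  least \<open>MEO H + MEO (shrink G H)\<close>. Both bounds are therefore equalities, and the marginals of an
  optimal pmf are forced to be optimal.

  The combinatorial statement about trees reduces to statements about connectedness, which are easily
  carried through the contraction walk by walk: among connected graphs, the trees are the ones with
  one edge fewer than vertices (\<open>is_tree_iff_card\<close>), and the edge and vertex counts of \<open>H\<close> and \<open>G/H\<close>
  add up correctly.
\<close>


section \<open>Counting the edges of a tree\<close>

lemma finite_multigraph_restrict:
  "finite_multigraph G \<Longrightarrow> F \<subseteq> edges G \<Longrightarrow> finite_multigraph (G\<lparr>edges := F\<rparr>)"
  by (auto simp: finite_multigraph_def intro: finite_subset)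

text \<open>
  Fix a root, measure the distance of vertices from it, and let every other vertex choose
  the first edge of a shortest walk to the root. The chosen edges connect everything to the root. No edge
  is chosen twice, because an edge is chosen by its endpoint that is farther from the root.
\<close>

lemma connected_subset_card:
  assumes fin: "finite_multigraph G" and con: "connected_graph G"
  obtains P where "P \<subseteq> edges G" "connected_graph (G\<lparr>edges := P\<rparr>)" "card P + 1 = card (verts G)"
proof -
  obtain r where r: "r \<in> verts G" using con by (auto simp: connected_graph_def)
  define d where "d v = (LEAST n. \<exists>p. walk G v p r \<and> length p = n)" for v
  have d_le: "d v \<le> length p" if "walk G v p r" for v p
    unfolding d_def using that by (intro Least_le) auto
  have "\<exists>e w. e \<in> edges G \<and> ends G e = {v, w} \<and> w \<in> verts G \<and> d w < d v"
    if v: "v \<in> verts G - {r}" for v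
  proof -
    have "\<exists>n p. walk G v p r \<and> length p = n" using con v r by (auto simp: connected_graph_def)
    then have "\<exists>p. walk G v p r \<and> length p = d v" unfolding d_def by (rule LeastI_ex)
    then obtain p where p: "walk G v p r" "length p = d v" by blast
    then obtain e w q where q: "p = (e, w) # q" using v by (cases p) auto
    then have "walk G w q r" using p by simp
    then show ?thesis using p q d_le[of w q] walk_ends[OF fin] by fastforce
  qed
  then obtain f g where f: "\<And>v. v \<in> verts G - {r} \<Longrightarrow>
      f v \<in> edges G \<and> ends G (f v) = {v, g v} \<and> g v \<in> verts G \<and> d (g v) < d v"
    by metis
  define P where "P = f ` (verts G - {r})"
  let ?G = "G\<lparr>edges := P\<rparr>"
  have sub: "P \<subseteq> edges G" using f by (auto simp: P_def)
  note finP = finite_multigraph_restrict[OF fin sub]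
  have inj: "inj_on f (verts G - {r})"
  proof (rule inj_onI, rule ccontr)
    fix u v assume u: "u \<in> verts G - {r}" and v: "v \<in> verts G - {r}" and "f u = f v" "u \<noteq> v"
    then have "{u, g u} = {v, g v}" using f[OF u] f[OF v] by metis
    then have "g u = v" "g v = u" using \<open>u \<noteq> v\<close> by (auto simp: doubleton_eq_iff)
    then show False using f[OF u] f[OF v] by auto
  qed
  have toroot: "\<exists>p. walk ?G v p r" if "v \<in> verts G" for v
    using that
  proof (induction "d v" arbitrary: v rule: less_induct)
    case less
    show ?case
    proof (cases "v = r")
      case True
      then have "walk ?G v [] r" using r by simp
      then show ?thesis by blast
    next
      case False
      then have v: "v \<in> verts G - {r}" using less.prems by simp
      then obtain p where "walk ?G (g v) p r" using f[OF v] less.hyps by blast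
      then have "walk ?G v ((f v, g v) # p) r" using f[OF v] v by (auto simp: P_def)
      then show ?thesis by blast
    qed
  qed
  have "\<exists>p. walk ?G u p v" if "u \<in> verts G" "v \<in> verts G" for u v
    using toroot[OF that(1)] toroot[OF that(2)] walk_rev[OF finP] walk_append by meson
  then have "connected_graph ?G" using r by (auto simp: connected_graph_def)
  moreover have "card P + 1 = card (verts G)"
    using card_image[OF inj] card_Suc_Diff1[OF _ r] fin by (auto simp: P_def finite_multigraph_def)
  ultimately show thesis using that sub by blast
qed

lemma walk_shorten:
  assumes "finite_multigraph G" "walk G u p v"
  shows "\<exists>q. walk G u q v \<and> distinct (u # map snd q)"
  using assms(2)
proof (induction p arbitrary: u)
  case Nil
  then show ?case by (intro exI[of _ "[]"]) auto
next
  case (Cons s p)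
  obtain e w where s: "s = (e, w)" by (cases s)
  have "walk G w p v" using Cons.prems s by simp
  then obtain q where q: "walk G w q v" "distinct (w # map snd q)" using Cons.IH by blast
  show ?case
  proof (cases "u \<in> set (w # map snd q)")
    case False
    then have "walk G u ((e, w) # q) v \<and> distinct (u # map snd ((e, w) # q))"
      using q Cons.prems s by auto
    then show ?thesis by blast
  next
    \<comment> \<open>If the walk returns to its start, its part before the return is dropped.\<close>
    case True
    have "walk G x q v \<Longrightarrow> distinct (x # map snd q) \<Longrightarrow> u \<in> set (x # map snd q)
      \<Longrightarrow> \<exists>q'. walk G u q' v \<and> distinct (u # map snd q')" for x
    proof (induction q arbitrary: x)
      case Nil
      then show ?case by (intro exI[of _ "[]"]) auto
    next
      case (Cons t q)
      obtain e' y where t: "t = (e', y)" by (cases t)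
      show ?case
      proof (cases "u = x")
        case True
        then show ?thesis using Cons.prems by blast
      next
        case False
        then show ?thesis using Cons.prems t by (intro Cons.IH[of y]) auto
      qed
    qed
    then show ?thesis using q True by blast
  qed
qed

lemma walk_edge_ends:
  "walk G u p v \<Longrightarrow> e \<in> fst ` set p \<Longrightarrow> ends G e \<subseteq> set (u # map snd p)"
  by (induction G u p v rule: walk.induct) auto

lemma walk_distinct_edges:
  "walk G u p v \<Longrightarrow> distinct (u # map snd p) \<Longrightarrow> distinct (map fst p)"
proof (induction G u p v rule: walk.induct)
  case (2 G u e w p v)
  then have "e \<notin> fst ` set p" using walk_edge_ends[of G w p v e] by auto
  then show ?case using 2 by auto
qed simp

text \<open>
  Shortening the walk makes its vertices distinct, and then its edges as well, so that closing it
  up with \<open>e\<close> yields a cycle and not just a closed walk.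
\<close>

lemma cycle_through_edge:
  assumes fin: "finite_multigraph G" and e: "e \<in> edges G" "ends G e = {a, b}"
    and F: "F \<subseteq> edges G - {e}" and w: "walk (G\<lparr>edges := F\<rparr>) b p a"
  shows "\<exists>q. is_cycle G a q"
proof -
  let ?F = "G\<lparr>edges := F\<rparr>"
  have "finite_multigraph ?F" using finite_multigraph_restrict[OF fin] F by blast
  then obtain q where q: "walk ?F b q a" "distinct (b # map snd q)"
    using walk_shorten[OF _ w] by blast
  have "walk (?F\<lparr>edges := edges G\<rparr>) b q a" by (rule walk_mono[OF q(1)]) (use F in auto)
  then have wG: "walk G b q a" by simp
  have "fst ` set q' \<subseteq> F" if "walk ?F x q' y" for x q' y
    using that by (induction ?F x q' y rule: walk.induct) auto
  then have "fst ` set q \<subseteq> F" using q(1) by blast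
  then have "e \<notin> set (map fst q)" using F by auto
  then have "is_cycle G a ((e, b) # q)"
    using wG q walk_distinct_edges[OF q] e by (auto simp: is_cycle_def)
  then show ?thesis by blast
qed

text \<open>
  Discarding an edge of a cycle keeps a graph connected, and so a connected graph with a cycle has
  an edge more than it needs; conversely, an edge outside a connected spanning set closes a cycle.
\<close>

lemma is_tree_iff_card:
  assumes fin: "finite_multigraph G"
  shows "is_tree G \<longleftrightarrow> connected_graph G \<and> card (edges G) + 1 = card (verts G)"
proof (intro iffI conjI)
  assume tree: "is_tree G"
  then show con: "connected_graph G" by (simp add: is_tree_def)
  obtain P where P: "P \<subseteq> edges G" "connected_graph (G\<lparr>edges := P\<rparr>)" "card P + 1 = card (verts G)"
    using connected_subset_card[OF fin con] .
  have "e \<in> P" if e: "e \<in> edges G" for e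
  proof (rule ccontr)
    assume "e \<notin> P"
    have e2: "card (ends G e) = 2" "ends G e \<subseteq> verts G" using fin e by (auto simp: finite_multigraph_def)
    then obtain a b where ab: "ends G e = {a, b}" by (meson card_2_iff)
    then obtain p where "walk (G\<lparr>edges := P\<rparr>) b p a" using P(2) e2
      by (fastforce simp: connected_graph_def)
    then show False
      using cycle_through_edge[OF fin e ab, of P] P(1) \<open>e \<notin> P\<close> tree by (auto simp: is_tree_def)
  qed
  then have "edges G = P" using P(1) by blast
  then show "card (edges G) + 1 = card (verts G)" using P(3) by simp
next
  assume "connected_graph G \<and> card (edges G) + 1 = card (verts G)"
  then have con: "connected_graph G" and card: "card (edges G) + 1 = card (verts G)" by auto
  have "\<not> is_cycle G u p" for u p
  proof
    assume c: "is_cycle G u p"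
    then obtain e w q where p: "p = (e, w) # q" by (cases p) (auto simp: is_cycle_def)
    have e: "e \<in> edges G" "ends G e = {w, u}" and q: "walk G w q u" and nq: "e \<notin> fst ` set q"
      using c unfolding p is_cycle_def by auto
    let ?G = "G\<lparr>edges := edges G - {e}\<rparr>"
    have d: "walk ?G w q u" by (rule walk_mono[OF q]) (use nq in auto)
    have "\<exists>r. walk ?G x r y" if xy: "x \<in> verts G" "y \<in> verts G" for x y
    proof -
      obtain s where "walk G x s y" using con xy unfolding connected_graph_def by blast
      then show ?thesis by (rule walk_detour[OF fin d e(2)])
    qed
    moreover have "verts G \<noteq> {}" using con unfolding connected_graph_def by blast
    ultimately have conE: "connected_graph ?G" by (simp add: connected_graph_def)
    have finE: "finite_multigraph ?G" by (rule finite_multigraph_restrict[OF fin]) blast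
    obtain P where "P \<subseteq> edges ?G" "card P + 1 = card (verts ?G)"
      using connected_subset_card[OF finE conE] .
    then have P: "P \<subseteq> edges G - {e}" "card P + 1 = card (verts G)" by simp_all
    have "finite (edges G)" using fin by (simp add: finite_multigraph_def)
    then have "card P < card (edges G)"
      using P(1) e(1) by (intro psubset_card_mono) auto
    then show False using P(2) card by simp
  qed
  then show "is_tree G" using con by (simp add: is_tree_def)
qed

lemma spanning_trees_iff_card:
  assumes "finite_multigraph G"
  shows "\<gamma> \<in> spanning_trees G \<longleftrightarrow>
    \<gamma> \<subseteq> edges G \<and> connected_graph (G\<lparr>edges := \<gamma>\<rparr>) \<and> card \<gamma> + 1 = card (verts G)"
  using is_tree_iff_card[OF finite_multigraph_restrict[OF assms]] by (auto simp: spanning_trees_def)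


section \<open>Spanning trees of a contraction\<close>

lemma homogeneous_coreD:
  assumes "homogeneous_core H G"
  shows "finite_multigraph H" "connected_graph H" "verts H \<subseteq> verts G" "edges H \<subseteq> edges G"
    "\<And>e. e \<in> edges H \<Longrightarrow> ends G e = ends H e" "\<And>e. e \<in> edges H \<Longrightarrow> ends G e \<subseteq> verts H"
    "\<And>\<gamma>. \<gamma> \<in> fair_trees G \<Longrightarrow> \<gamma> \<inter> edges H \<in> spanning_trees H"
proof -
  have sub: "is_subgraph H G" and fair: "\<forall>\<gamma>\<in>fair_trees G. \<gamma> \<inter> edges H \<in> spanning_trees H"
    using assms unfolding homogeneous_core_def by blast+
  show "connected_graph H" using assms unfolding homogeneous_core_def by blast
  show fin: "finite_multigraph H" and "verts H \<subseteq> verts G" "edges H \<subseteq> edges G"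
    using sub unfolding is_subgraph_def by blast+
  show ends: "ends G e = ends H e" if "e \<in> edges H" for e
    using sub that unfolding is_subgraph_def by metis
  show "ends G e \<subseteq> verts H" if "e \<in> edges H" for e
    using fin that unfolding ends[OF that] finite_multigraph_def by blast
  show "\<gamma> \<inter> edges H \<in> spanning_trees H" if "\<gamma> \<in> fair_trees G" for \<gamma>
    using fair that by blast
qed

lemma card_verts_shrink:
  assumes G: "finite_multigraph G" and H: "homogeneous_core H G"
  shows "card (verts (shrink G H)) + card (verts H) = card (verts G) + 1"
proof -
  have "card (verts (shrink G H)) = card (verts G - verts H) + 1"
    using G by (simp add: shrink_def finite_multigraph_def card_image)
  moreover have "card (verts G - verts H) + card (verts H) = card (verts G)"
    using G homogeneous_coreD(3)[OF H]
    by (metis card_Diff_subset card_mono finite_multigraph_def finite_subset le_add_diff_inverse2)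
  ultimately show ?thesis by simp
qed

text \<open>Contracting a walk drops its steps inside \<open>H\<close>.\<close>

lemma walk_shrink:
  assumes H: "homogeneous_core H G" and w: "walk (G\<lparr>edges := \<gamma>\<rparr>) u p v"
  shows "\<exists>q. walk ((shrink G H)\<lparr>edges := \<gamma> - edges H\<rparr>) (shrink_vertex H u) q (shrink_vertex H v)"
  using w
proof (induction p arbitrary: u)
  case Nil
  then show ?case by (intro exI[of _ "[]"]) (auto simp: shrink_def shrink_vertex_def)
next
  case (Cons s p)
  obtain e x where s: "s = (e, x)" by (cases s)
  let ?S = "(shrink G H)\<lparr>edges := \<gamma> - edges H\<rparr>"
  obtain q where q: "walk ?S (shrink_vertex H x) q (shrink_vertex H v)" using Cons s by auto
  show ?case
  proof (cases "e \<in> edges H")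
    case True
    then have "u \<in> verts H" "x \<in> verts H" using homogeneous_coreD(6)[OF H True] Cons s by auto
    then have "shrink_vertex H u = shrink_vertex H x" by (simp add: shrink_vertex_def)
    then show ?thesis using q by auto
  next
    case False
    then have "walk ?S (shrink_vertex H u) ((e, shrink_vertex H x) # q) (shrink_vertex H v)"
      using q Cons.prems s by (auto simp: shrink_def)
    then show ?thesis by blast
  qed
qed

lemma connected_shrink:
  assumes H: "homogeneous_core H G" and con: "connected_graph (G\<lparr>edges := \<gamma>\<rparr>)"
  shows "connected_graph ((shrink G H)\<lparr>edges := \<gamma> - edges H\<rparr>)"
proof -
  let ?S = "(shrink G H)\<lparr>edges := \<gamma> - edges H\<rparr>"
  obtain h where h: "h \<in> verts H" using homogeneous_coreD(2)[OF H] by (auto simp: connected_graph_def)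
  have pre: "\<exists>u\<in>verts G. x = shrink_vertex H u" if "x \<in> verts ?S" for x
  proof (cases x)
    case None
    then show ?thesis using h homogeneous_coreD(3)[OF H] by (auto simp: shrink_vertex_def)
  next
    case (Some u)
    then show ?thesis using that by (auto simp: shrink_vertex_def shrink_def)
  qed
  have "\<exists>q. walk ?S x q y" if xy: "x \<in> verts ?S" "y \<in> verts ?S" for x y
  proof -
    obtain u v where uv: "u \<in> verts G" "v \<in> verts G" "x = shrink_vertex H u" "y = shrink_vertex H v"
      using pre[OF xy(1)] pre[OF xy(2)] by blast
    then obtain p where "walk (G\<lparr>edges := \<gamma>\<rparr>) u p v" using con by (auto simp: connected_graph_def)
    then show ?thesis using walk_shrink[OF H] uv by blast
  qed
  then show ?thesis unfolding connected_graph_def by (simp add: shrink_def)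
qed

text \<open>
  A walk of \<open>G/H\<close> is lifted by inserting, at every visit of the contracted vertex, a walk inside
  \<open>H\<close> between the two vertices at which the lifted edges enter and leave \<open>H\<close>. To make the
  induction work, the endpoints of the lifted walk are allowed to be any preimages.
\<close>

lemma walk_unshrink:
  assumes G: "finite_multigraph G" and H: "homogeneous_core H G"
    and \<gamma>\<^sub>1: "\<gamma>\<^sub>1 \<subseteq> edges H" "connected_graph (H\<lparr>edges := \<gamma>\<^sub>1\<rparr>)"
    and \<gamma>\<^sub>2: "\<gamma>\<^sub>2 \<subseteq> edges (shrink G H)"
    and w: "walk ((shrink G H)\<lparr>edges := \<gamma>\<^sub>2\<rparr>) x p y"
    and uv: "u \<in> verts G" "v \<in> verts G" "shrink_vertex H u = x" "shrink_vertex H v = y"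
  shows "\<exists>q. walk (G\<lparr>edges := \<gamma>\<^sub>1 \<union> \<gamma>\<^sub>2\<rparr>) u q v"
proof -
  let ?G = "G\<lparr>edges := \<gamma>\<^sub>1 \<union> \<gamma>\<^sub>2\<rparr>"
  have lift: "walk ?G a q b" if "walk (H\<lparr>edges := \<gamma>\<^sub>1\<rparr>) a q b" for a q b
    using that
  proof (induction q arbitrary: a)
    case Nil
    then show ?case using homogeneous_coreD(3)[OF H] by auto
  next
    case (Cons s q)
    then show ?case using homogeneous_coreD(5)[OF H] \<gamma>\<^sub>1(1) by (cases s) auto
  qed
  have fibre: "\<exists>q. walk ?G a q b"
    if "a \<in> verts G" "b \<in> verts G" "shrink_vertex H a = shrink_vertex H b" for a b
  proof (cases "a \<in> verts H")
    case True
    then have "b \<in> verts H" using that by (auto simp: shrink_vertex_def split: if_splits)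
    then obtain q where "walk (H\<lparr>edges := \<gamma>\<^sub>1\<rparr>) a q b"
      using \<gamma>\<^sub>1(2) True by (auto simp: connected_graph_def)
    then show ?thesis using lift by blast
  next
    case False
    then have "walk ?G a [] b" using that by (auto simp: shrink_vertex_def split: if_splits)
    then show ?thesis by blast
  qed
  show ?thesis
    using w uv
  proof (induction p arbitrary: u x)
    case Nil
    then show ?case using fibre[of u v] by auto
  next
    case (Cons s p)
    obtain e z where s: "s = (e, z)" by (cases s)
    have e: "e \<in> \<gamma>\<^sub>2" "shrink_vertex H ` ends G e = {x, z}"
      and rest: "walk ((shrink G H)\<lparr>edges := \<gamma>\<^sub>2\<rparr>) z p y"
      using Cons.prems s by (auto simp: shrink_def)
    have "e \<in> edges G" using e(1) \<gamma>\<^sub>2 by (auto simp: shrink_def)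
    then have e2: "card (ends G e) = 2" "ends G e \<subseteq> verts G"
      using G by (auto simp: finite_multigraph_def)
    then obtain a b where "ends G e = {a, b}" by (meson card_2_iff)
    moreover from this have "shrink_vertex H a = x \<and> shrink_vertex H b = z \<or>
        shrink_vertex H b = x \<and> shrink_vertex H a = z"
      using e(2) by (auto simp: doubleton_eq_iff)
    ultimately obtain a b where ab: "ends G e = {a, b}" "shrink_vertex H a = x" "shrink_vertex H b = z"
      by (metis insert_commute)
    obtain q where q: "walk ?G u q a" using fibre[of u a] ab e2 Cons.prems by auto
    obtain q' where "walk ?G b q' v" using Cons.IH[OF rest, of b] ab e2 Cons.prems by auto
    then have "walk ?G a ((e, b) # q') v" using e(1) ab by auto
    then show ?case using walk_append[OF q] by blast
  qed
qed

lemma connected_unshrink: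
  assumes G: "finite_multigraph G" and H: "homogeneous_core H G"
    and \<gamma>\<^sub>1: "\<gamma>\<^sub>1 \<subseteq> edges H" "connected_graph (H\<lparr>edges := \<gamma>\<^sub>1\<rparr>)"
    and \<gamma>\<^sub>2: "\<gamma>\<^sub>2 \<subseteq> edges (shrink G H)" "connected_graph ((shrink G H)\<lparr>edges := \<gamma>\<^sub>2\<rparr>)"
  shows "connected_graph (G\<lparr>edges := \<gamma>\<^sub>1 \<union> \<gamma>\<^sub>2\<rparr>)"
proof -
  have "\<exists>q. walk (G\<lparr>edges := \<gamma>\<^sub>1 \<union> \<gamma>\<^sub>2\<rparr>) u q v" if uv: "u \<in> verts G" "v \<in> verts G" for u v
  proof -
    have "shrink_vertex H u \<in> verts (shrink G H)" "shrink_vertex H v \<in> verts (shrink G H)"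
      using uv by (auto simp: shrink_def shrink_vertex_def)
    then obtain p where "walk ((shrink G H)\<lparr>edges := \<gamma>\<^sub>2\<rparr>) (shrink_vertex H u) p (shrink_vertex H v)"
      using \<gamma>\<^sub>2(2) by (auto simp: connected_graph_def)
    then show ?thesis using walk_unshrink[OF G H \<gamma>\<^sub>1 \<gamma>\<^sub>2(1)] uv by blast
  qed
  moreover have "verts G \<noteq> {}" using homogeneous_coreD(2,3)[OF H] by (auto simp: connected_graph_def)
  ultimately show ?thesis by (simp add: connected_graph_def)
qed

text \<open>
  Absence of cycles is hard to follow through a contraction, since a cycle of \<open>G\<close> may pass through \<open>H\<close>
  several times. The following two lemmas verify instead that the numbers of edges are right.
\<close>

lemma spanning_trees_union:
  assumes G: "finite_multigraph G" and H: "homogeneous_core H G"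
    and \<gamma>\<^sub>1: "\<gamma>\<^sub>1 \<in> spanning_trees H" and \<gamma>\<^sub>2: "\<gamma>\<^sub>2 \<in> spanning_trees (shrink G H)"
  shows "\<gamma>\<^sub>1 \<union> \<gamma>\<^sub>2 \<in> spanning_trees G"
proof -
  note finS = finite_multigraph_shrink[OF G H] and finH = homogeneous_coreD(1)[OF H]
  have g1: "\<gamma>\<^sub>1 \<subseteq> edges H" "connected_graph (H\<lparr>edges := \<gamma>\<^sub>1\<rparr>)" "card \<gamma>\<^sub>1 + 1 = card (verts H)"
    using \<gamma>\<^sub>1 spanning_trees_iff_card[OF finH] by auto
  have g2: "\<gamma>\<^sub>2 \<subseteq> edges (shrink G H)" "connected_graph ((shrink G H)\<lparr>edges := \<gamma>\<^sub>2\<rparr>)"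
      "card \<gamma>\<^sub>2 + 1 = card (verts (shrink G H))"
    using \<gamma>\<^sub>2 spanning_trees_iff_card[OF finS] by auto
  have sub: "\<gamma>\<^sub>1 \<union> \<gamma>\<^sub>2 \<subseteq> edges G" and dis: "\<gamma>\<^sub>1 \<inter> \<gamma>\<^sub>2 = {}"
    using g1(1) g2(1) homogeneous_coreD(4)[OF H] by (auto simp: shrink_def)
  have "finite (\<gamma>\<^sub>1 \<union> \<gamma>\<^sub>2)" using sub G by (auto simp: finite_multigraph_def intro: finite_subset)
  then have "card (\<gamma>\<^sub>1 \<union> \<gamma>\<^sub>2) = card \<gamma>\<^sub>1 + card \<gamma>\<^sub>2" using dis by (simp add: card_Un_disjoint)
  then show ?thesis
    using spanning_trees_iff_card[OF G] sub connected_unshrink[OF G H g1(1,2) g2(1,2)] g1(3) g2(3)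
      card_verts_shrink[OF G H] by auto
qed

lemma spanning_trees_diff:
  assumes G: "finite_multigraph G" and H: "homogeneous_core H G"
    and \<gamma>: "\<gamma> \<in> spanning_trees G" and \<gamma>\<^sub>1: "\<gamma> \<inter> edges H \<in> spanning_trees H"
  shows "\<gamma> - edges H \<in> spanning_trees (shrink G H)"
proof -
  note finS = finite_multigraph_shrink[OF G H] and finH = homogeneous_coreD(1)[OF H]
  have g: "\<gamma> \<subseteq> edges G" "connected_graph (G\<lparr>edges := \<gamma>\<rparr>)" "card \<gamma> + 1 = card (verts G)"
    using \<gamma> spanning_trees_iff_card[OF G] by auto
  have g1: "card (\<gamma> \<inter> edges H) + 1 = card (verts H)"
    using \<gamma>\<^sub>1 spanning_trees_iff_card[OF finH] by auto
  have "finite \<gamma>" using g(1) G by (auto simp: finite_multigraph_def intro: finite_subset)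
  then have "card (\<gamma> - edges H) + card (\<gamma> \<inter> edges H) = card \<gamma>"
    by (metis card_Int_Diff add.commute)
  then have "card (\<gamma> - edges H) + 1 = card (verts (shrink G H))"
    using g(3) g1 card_verts_shrink[OF G H] by auto
  moreover have "\<gamma> - edges H \<subseteq> edges (shrink G H)" using g(1) by (auto simp: shrink_def)
  ultimately show ?thesis
    using spanning_trees_iff_card[OF finS] connected_shrink[OF H g(2)] by auto
qed


section \<open>Couplings\<close>

lemma usage_eq_prob:
  assumes fin: "finite_multigraph G" and \<mu>: "\<mu> \<in> tree_pmfs G"
  shows "usage G \<mu> e = measure_pmf.prob \<mu> {\<gamma>. e \<in> \<gamma>}"
proof -
  have "measure_pmf.prob \<mu> {\<gamma>. e \<in> \<gamma>} = measure_pmf.prob \<mu> {\<gamma> \<in> spanning_trees G. e \<in> \<gamma>}"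
    using \<mu> by (intro measure_pmf.finite_measure_eq_AE)
      (auto simp: AE_measure_pmf_iff tree_pmfs_def)
  also have "\<dots> = usage G \<mu> e"
    using finite_spanning_trees[OF fin] by (simp add: usage_def measure_measure_pmf_finite)
  finally show ?thesis by simp
qed

lemma union_pmf_tree_pmfs:
  assumes G: "finite_multigraph G" and H: "homogeneous_core H G"
    and \<pi>: "is_coupling \<pi> \<mu>\<^sub>1 \<mu>\<^sub>2" "\<mu>\<^sub>1 \<in> tree_pmfs H" "\<mu>\<^sub>2 \<in> tree_pmfs (shrink G H)"
  shows "union_pmf \<pi> \<in> tree_pmfs G"
proof -
  have "set_pmf \<pi> \<subseteq> spanning_trees H \<times> spanning_trees (shrink G H)"
    using \<pi> by (force simp: is_coupling_def tree_pmfs_def)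
  then show ?thesis
    using spanning_trees_union[OF G H] by (force simp: tree_pmfs_def union_pmf_def)
qed

lemma expected_overlap_union_pmf:
  assumes G: "finite_multigraph G" and H: "homogeneous_core H G"
    and \<pi>: "is_coupling \<pi> \<mu>\<^sub>1 \<mu>\<^sub>2" "\<mu>\<^sub>1 \<in> tree_pmfs H" "\<mu>\<^sub>2 \<in> tree_pmfs (shrink G H)"
  shows "expected_overlap G (union_pmf \<pi>) = expected_overlap H \<mu>\<^sub>1 + expected_overlap (shrink G H) \<mu>\<^sub>2"
proof -
  note finS = finite_multigraph_shrink[OF G H] and finH = homogeneous_coreD(1)[OF H]
  note mem = union_pmf_tree_pmfs[OF G H \<pi>]
  have m1: "\<mu>\<^sub>1 = map_pmf fst \<pi>" and m2: "\<mu>\<^sub>2 = map_pmf snd \<pi>" using \<pi>(1) by (auto simp: is_coupling_def)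
  have supp: "\<gamma>\<^sub>1 \<subseteq> edges H \<and> \<gamma>\<^sub>2 \<subseteq> edges G - edges H" if p: "(\<gamma>\<^sub>1, \<gamma>\<^sub>2) \<in> set_pmf \<pi>" for \<gamma>\<^sub>1 \<gamma>\<^sub>2
  proof -
    have "\<gamma>\<^sub>1 \<in> set_pmf \<mu>\<^sub>1" "\<gamma>\<^sub>2 \<in> set_pmf \<mu>\<^sub>2" unfolding m1 m2 set_map_pmf using p by force+
    then have "\<gamma>\<^sub>1 \<in> spanning_trees H" "\<gamma>\<^sub>2 \<in> spanning_trees (shrink G H)"
      using \<pi>(2,3) unfolding tree_pmfs_def by blast+
    then show ?thesis by (simp add: spanning_trees_def shrink_def)
  qed
  have uG: "usage G (union_pmf \<pi>) e = measure_pmf.prob \<pi> {(\<gamma>\<^sub>1, \<gamma>\<^sub>2). e \<in> \<gamma>\<^sub>1 \<union> \<gamma>\<^sub>2}" for e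
    by (simp add: usage_eq_prob[OF G mem]) (simp add: union_pmf_def vimage_def case_prod_unfold)
  have u1: "usage G (union_pmf \<pi>) e = usage H \<mu>\<^sub>1 e" if "e \<in> edges H" for e
  proof -
    have "usage H \<mu>\<^sub>1 e = measure_pmf.prob \<pi> {(\<gamma>\<^sub>1, \<gamma>\<^sub>2). e \<in> \<gamma>\<^sub>1}"
      by (simp add: usage_eq_prob[OF finH \<pi>(2)]) (simp add: m1 vimage_def case_prod_unfold)
    also have "\<dots> = usage G (union_pmf \<pi>) e"
      unfolding uG using supp that
      by (intro measure_pmf.finite_measure_eq_AE) (auto simp: AE_measure_pmf_iff)
    finally show ?thesis by simp
  qed
  have u2: "usage G (union_pmf \<pi>) e = usage (shrink G H) \<mu>\<^sub>2 e" if "e \<in> edges G - edges H" for e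
  proof -
    have "usage (shrink G H) \<mu>\<^sub>2 e = measure_pmf.prob \<pi> {(\<gamma>\<^sub>1, \<gamma>\<^sub>2). e \<in> \<gamma>\<^sub>2}"
      by (simp add: usage_eq_prob[OF finS \<pi>(3)]) (simp add: m2 vimage_def case_prod_unfold)
    also have "\<dots> = usage G (union_pmf \<pi>) e"
      unfolding uG using supp that
      by (intro measure_pmf.finite_measure_eq_AE) (auto simp: AE_measure_pmf_iff)
    finally show ?thesis by simp
  qed
  have "expected_overlap G (union_pmf \<pi>) = (\<Sum>e\<in>edges G - edges H. (usage G (union_pmf \<pi>) e)\<^sup>2)
      + (\<Sum>e\<in>edges H. (usage G (union_pmf \<pi>) e)\<^sup>2)"
    unfolding expected_overlap_usage[OF G] using G homogeneous_coreD(4)[OF H]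
    by (intro sum.subset_diff) (auto simp: finite_multigraph_def)
  also have "\<dots> = expected_overlap (shrink G H) \<mu>\<^sub>2 + expected_overlap H \<mu>\<^sub>1"
    unfolding expected_overlap_usage[OF finS] expected_overlap_usage[OF finH]
    by (simp add: u1 u2 shrink_def)
  finally show ?thesis by simp
qed

text \<open>
  An optimal pmf charges only fair trees, which meet \<open>H\<close> in spanning trees of \<open>H\<close>. The coupling cuts each
  of them into its edges inside and outside \<open>H\<close>.
\<close>

lemma optimal_is_union_pmf:
  assumes G: "finite_multigraph G" and H: "homogeneous_core H G" and opt: "optimal G \<mu>"
  obtains \<pi> \<mu>\<^sub>1 \<mu>\<^sub>2 where "is_coupling \<pi> \<mu>\<^sub>1 \<mu>\<^sub>2" "\<mu>\<^sub>1 \<in> tree_pmfs H" "\<mu>\<^sub>2 \<in> tree_pmfs (shrink G H)"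
    "\<mu> = union_pmf \<pi>"
proof
  let ?\<pi> = "map_pmf (\<lambda>\<gamma>. (\<gamma> \<inter> edges H, \<gamma> - edges H)) \<mu>"
  have tree: "\<gamma> \<in> spanning_trees G" and core: "\<gamma> \<inter> edges H \<in> spanning_trees H"
    if "\<gamma> \<in> set_pmf \<mu>" for \<gamma>
  proof -
    show "\<gamma> \<in> spanning_trees G" using opt that by (auto simp: optimal_def tree_pmfs_def)
    then have "\<gamma> \<in> fair_trees G" using opt that by (auto simp: fair_trees_def pmf_positive)
    then show "\<gamma> \<inter> edges H \<in> spanning_trees H" by (rule homogeneous_coreD(7)[OF H])
  qed
  show "is_coupling ?\<pi> (map_pmf fst ?\<pi>) (map_pmf snd ?\<pi>)" by (simp add: is_coupling_def)
  show "map_pmf fst ?\<pi> \<in> tree_pmfs H" using core by (auto simp: tree_pmfs_def)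
  show "map_pmf snd ?\<pi> \<in> tree_pmfs (shrink G H)"
    using spanning_trees_diff[OF G H tree core] by (auto simp: tree_pmfs_def)
  show "\<mu> = union_pmf ?\<pi>"
    by (simp add: union_pmf_def map_pmf_comp Int_Diff_Un)
qed


section \<open>Additivity of the minimum expected overlap\<close>

theorem theorem1p3:
  fixes G H :: "('v, 'e) multigraph"
  assumes "finite_multigraph G"
    and "connected_graph G"
    and "homogeneous_core H G"
    and "is_proper_subgraph H G"
  shows "MEO G = MEO H + MEO (shrink G H)
    \<and> (\<forall>\<mu>\<^sub>1 \<mu>\<^sub>2 \<pi>. optimal H \<mu>\<^sub>1 \<and> optimal (shrink G H) \<mu>\<^sub>2 \<and> is_coupling \<pi> \<mu>\<^sub>1 \<mu>\<^sub>2
          \<longrightarrow> optimal G (union_pmf \<pi>))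
    \<and> (\<forall>\<mu>. optimal G \<mu> \<longrightarrow>
          (\<exists>\<mu>\<^sub>1 \<mu>\<^sub>2 \<pi>. optimal H \<mu>\<^sub>1 \<and> optimal (shrink G H) \<mu>\<^sub>2 \<and> is_coupling \<pi> \<mu>\<^sub>1 \<mu>\<^sub>2
             \<and> \<mu> = union_pmf \<pi>))"
proof -
  note G = assms(1) and con = assms(2) and H = assms(3)
  let ?S = "shrink G H"
  have "connected_graph (?S\<lparr>edges := edges G - edges H\<rparr>)"
    using connected_shrink[OF H, of "edges G"] con by simp
  then have conS: "connected_graph ?S" by (simp add: shrink_def)
  have le: "MEO G \<le> MEO H + MEO ?S"
  proof -
    obtain \<mu>\<^sub>1 \<mu>\<^sub>2 where opt: "optimal H \<mu>\<^sub>1" "optimal ?S \<mu>\<^sub>2"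
      using optimal_exists[OF homogeneous_coreD(1,2)[OF H]]
        optimal_exists[OF finite_multigraph_shrink[OF G H] conS] by blast
    have c: "is_coupling (pair_pmf \<mu>\<^sub>1 \<mu>\<^sub>2) \<mu>\<^sub>1 \<mu>\<^sub>2"
      by (simp add: is_coupling_def map_fst_pair_pmf map_snd_pair_pmf)
    show ?thesis
      using MEO_le[OF union_pmf_tree_pmfs[OF G H c]] expected_overlap_union_pmf[OF G H c] opt
      by (simp add: optimal_def)
  qed
  \<comment> \<open>Together with \<open>le\<close>, the value of an optimal pmf of \<open>G\<close> squeezes both marginals to the minimum.\<close>
  have split: "MEO G = MEO H + MEO ?S \<and>
      (\<exists>\<mu>\<^sub>1 \<mu>\<^sub>2 \<pi>. optimal H \<mu>\<^sub>1 \<and> optimal ?S \<mu>\<^sub>2 \<and> is_coupling \<pi> \<mu>\<^sub>1 \<mu>\<^sub>2 \<and> \<mu> = union_pmf \<pi>)"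
    if opt: "optimal G \<mu>" for \<mu>
  proof -
    obtain \<pi> \<mu>\<^sub>1 \<mu>\<^sub>2 where p: "is_coupling \<pi> \<mu>\<^sub>1 \<mu>\<^sub>2" "\<mu>\<^sub>1 \<in> tree_pmfs H" "\<mu>\<^sub>2 \<in> tree_pmfs ?S"
        "\<mu> = union_pmf \<pi>"
      using optimal_is_union_pmf[OF G H opt] .
    have "MEO G = expected_overlap H \<mu>\<^sub>1 + expected_overlap ?S \<mu>\<^sub>2"
      using expected_overlap_union_pmf[OF G H p(1-3)] opt p(4) by (simp add: optimal_def)
    moreover have "MEO H \<le> expected_overlap H \<mu>\<^sub>1" "MEO ?S \<le> expected_overlap ?S \<mu>\<^sub>2"
      using p by (auto intro: MEO_le)
    ultimately have "expected_overlap H \<mu>\<^sub>1 = MEO H" "expected_overlap ?S \<mu>\<^sub>2 = MEO ?S"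
        "MEO G = MEO H + MEO ?S"
      using le by auto
    then show ?thesis using p by (auto simp: optimal_def)
  qed
  have eq: "MEO G = MEO H + MEO ?S" using split optimal_exists[OF G con] by blast
  have "optimal G (union_pmf \<pi>)"
    if "optimal H \<mu>\<^sub>1" "optimal ?S \<mu>\<^sub>2" "is_coupling \<pi> \<mu>\<^sub>1 \<mu>\<^sub>2" for \<mu>\<^sub>1 \<mu>\<^sub>2 \<pi>
    using that union_pmf_tree_pmfs[OF G H that(3)] expected_overlap_union_pmf[OF G H that(3)] eq
    by (simp add: optimal_def)
  then show ?thesis using eq split by blast
qed

end
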